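(* Let $A=(a(i,j))_{i,j\ge 0}$ be the infinite lower triangular matrix with $a(n,k)=(-1)^{n-k}\frac{1}{2k+1}\binom{2n+2}{2k}G_{2n-2k+2}$ for $0\le k\le n$ and $a(n,k)=0$ for $k>n$. Then $A$ has the following three representations: $$A=\left([j\le i]\binom{2i+1-j}{j}\right)_{i,j\ge 0}\left(\left([j\le i]\binom{2i-j}{j}\right)_{i,j\ge 0}\right)^{-1},$$ $$A=\left(\left([j\le i]\binom{i+1}{2i-2j}\right)_{i,j\ge 0}\right)^{-1}\left([j\le i]\binom{i+1}{2i-2j+1}\right)_{i,j\ge 0},$$ $$A=\bigl(T(i+1,j+1)\bigr)_{i,j\ge 0}\,\bigl([i=j](i+1)\bigr)_{i,j\ge 0}\,\bigl(t(i+1,j+1)\bigr)_{i,j\ge 0}.$$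
   Context: $[P]=1$ if the property $P$ holds and $[P]=0$ otherwise. All matrices are infinite lower triangular matrices indexed by $i,j\ge 0$ (row $i$, column $j$), so products and inverses (nonzero diagonals) are well defined. The Genocchi numbers $G_{2n}$, $n\ge1$ ($1,1,3,17,155,\dots$), are defined by $\frac{2z}{1+e^z}=z+\sum_{n\ge 1}(-1)^nG_{2n}\frac{z^{2n}}{(2n)!}$. The central factorial numbers of the second kind $T(n,k)$, $n,k\ge0$, are defined by $T(0,k)=[k=0]$, $T(n,0)=0$ for $n\ge1$, and $T(n,k)=T(n-1,k-1)+k^2T(n-1,k)$ for $n,k\ge 1$. The central factorial numbers of the first kind $t(n,k)$ are defined by $t(0,k)=[k=0]$, $t(n,0)=0$ for $n\ge1$, and $t(n,k)=t(n-1,k-1)-(n-1)^2t(n-1,k)$ for $n,k\ge1$. *)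

theory Defs
  imports "HOL-Computational_Algebra.Computational_Algebra"
begin

(* An infinite matrix with rows and columns indexed from 0 is a function of the row and the
   column index. *)
type_synonym 'a inf_matrix = "nat \<Rightarrow> nat \<Rightarrow> 'a"

definition lower_triangular :: "'a::zero inf_matrix \<Rightarrow> bool" where
  "lower_triangular A \<longleftrightarrow> (\<forall>i j. i < j \<longrightarrow> A i j = 0)"

definition inf_one :: "'a::zero_neq_one inf_matrix" where
  "inf_one = (\<lambda>i j. of_bool (i = j))"

(* For lower triangular A the omitted terms, k > i, of the (i, j) entry all vanish; for other A
   this is not the usual product. *)
definition inf_mult :: "'a::semiring_0 inf_matrix \<Rightarrow> 'a inf_matrix \<Rightarrow> 'a inf_matrix"
    (infixl "\<odot>" 70) where
  "A \<odot> B = (\<lambda>i j. \<Sum>k\<le>i. A i k * B k j)"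

(* The two-sided inverse among lower triangular matrices; it is unspecified for a matrix without
   one.  See inf_inverse_properties below. *)
definition inf_inverse :: "'a::field inf_matrix \<Rightarrow> 'a inf_matrix" where
  "inf_inverse A = (THE B. lower_triangular B \<and> A \<odot> B = inf_one \<and> B \<odot> A = inf_one)"

(* genocchi m is G_m for even m \<ge> 2, read off from the generating function 2z / (1 + e^z);
   values at other m are not used.  See genocchi_gf below. *)
definition genocchi :: "nat \<Rightarrow> rat" where
  "genocchi m = (-1) ^ (m div 2) * fact m * fps_nth (2 * fps_X / (1 + fps_exp 1)) m"

fun central_fact2 :: "nat \<Rightarrow> nat \<Rightarrow> nat" where
  "central_fact2 0 k = of_bool (k = 0)"
| "central_fact2 (Suc n) 0 = 0"
| "central_fact2 (Suc n) (Suc k) =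
     central_fact2 n k + (Suc k)\<^sup>2 * central_fact2 n (Suc k)"

fun central_fact1 :: "nat \<Rightarrow> nat \<Rightarrow> int" where
  "central_fact1 0 k = of_bool (k = 0)"
| "central_fact1 (Suc n) 0 = 0"
| "central_fact1 (Suc n) (Suc k) =
     central_fact1 n k - (int n)\<^sup>2 * central_fact1 n (Suc k)"

lemma lower_triangular_central_fact2:
  "n < k \<Longrightarrow> central_fact2 n k = 0"
  by (induction n k rule: central_fact2.induct) auto

lemma lower_triangular_central_fact1:
  "n < k \<Longrightarrow> central_fact1 n k = 0"
  by (induction n k rule: central_fact1.induct) auto

lemma inf_mult_assoc:
  assumes "lower_triangular B"
  shows "A \<odot> B \<odot> C = A \<odot> (B \<odot> C)"
proof (intro ext)
  fix i j
  have "(A \<odot> B \<odot> C) i j = (\<Sum>k\<le>i. \<Sum>l\<le>i. A i l * B l k * C k j)"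
    by (simp add: inf_mult_def sum_distrib_right)
  also have "\<dots> = (\<Sum>l\<le>i. \<Sum>k\<le>i. A i l * B l k * C k j)"
    by (rule sum.swap)
  also have "\<dots> = (\<Sum>l\<le>i. \<Sum>k\<le>l. A i l * B l k * C k j)"
    using assms by (intro sum.cong sum.mono_neutral_right) (auto simp: lower_triangular_def)
  also have "\<dots> = (A \<odot> (B \<odot> C)) i j"
    by (simp add: inf_mult_def sum_distrib_left mult.assoc)
  finally show "(A \<odot> B \<odot> C) i j = (A \<odot> (B \<odot> C)) i j" .
qed

lemma inf_one_mult: "inf_one \<odot> A = (A :: 'a::semiring_1 inf_matrix)"
  by (intro ext) (simp add: inf_mult_def inf_one_def if_distrib of_bool_def if_distribR cong: if_cong)

lemma inf_mult_one:
  "lower_triangular A \<Longrightarrow> A \<odot> inf_one = (A :: 'a::semiring_1 inf_matrix)"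
  by (intro ext)
     (auto simp: inf_mult_def inf_one_def lower_triangular_def of_bool_def if_distrib cong: if_cong)

fun right_inverse :: "'a::field inf_matrix \<Rightarrow> 'a inf_matrix" where
  "right_inverse A i =
     (\<lambda>j. (of_bool (i = j) - (\<Sum>k\<in>{..<i}. A i k * right_inverse A k j)) / A i i)"

declare right_inverse.simps [simp del]

lemma right_inverse:
  assumes "lower_triangular A" "\<And>i. A i i \<noteq> 0"
  shows "lower_triangular (right_inverse A)" "A \<odot> right_inverse A = inf_one"
    "right_inverse A i i \<noteq> 0"
proof -
  have zero: "right_inverse A i j = 0" if "i < j" for i j
    using that
    by (induction i rule: less_induct) (subst right_inverse.simps, simp)
  then show "lower_triangular (right_inverse A)"
    by (simp add: lower_triangular_def)
  show "A \<odot> right_inverse A = inf_one"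
  proof (intro ext)
    fix i j
    have "(A \<odot> right_inverse A) i j =
        (\<Sum>k<i. A i k * right_inverse A k j) + A i i * right_inverse A i j"
      by (simp add: inf_mult_def flip: lessThan_Suc_atMost)
    also have "A i i * right_inverse A i j = of_bool (i = j) - (\<Sum>k<i. A i k * right_inverse A k j)"
      by (subst right_inverse.simps) (simp add: assms(2))
    finally show "(A \<odot> right_inverse A) i j = inf_one i j"
      by (simp add: inf_one_def)
  qed
  show "right_inverse A i i \<noteq> 0"
    by (subst right_inverse.simps) (simp add: zero assms(2))
qed

lemma inf_inverse_properties:
  assumes "lower_triangular A" "\<And>i. A i i \<noteq> 0"
  shows "lower_triangular (inf_inverse A)" "A \<odot> inf_inverse A = inf_one"
    "inf_inverse A \<odot> A = inf_one"
proof -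
  let ?C = "right_inverse A"
  let ?D = "right_inverse ?C"
  note C = right_inverse[OF assms]
  note D = right_inverse[OF C(1) C(3)]
  have "A = A \<odot> (?C \<odot> ?D)"
    by (simp add: D(2) inf_mult_one assms(1))
  also have "\<dots> = ?D"
    by (simp add: C(2) inf_one_mult flip: inf_mult_assoc[OF C(1)])
  finally have CA: "?C \<odot> A = inf_one"
    using D(2) by simp
  define P where "P = (\<lambda>B. lower_triangular B \<and> A \<odot> B = inf_one \<and> B \<odot> A = inf_one)"
  have "P ?C"
    using C(1,2) CA by (simp add: P_def)
  moreover have "B = ?C" if "P B" for B
    using that C(1,2) assms(1) unfolding P_def
    by (metis inf_mult_assoc inf_mult_one inf_one_mult)
  ultimately have "P (THE B. P B)"
    by (rule theI)
  then have "lower_triangular (inf_inverse A) \<and> A \<odot> inf_inverse A = inf_one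
      \<and> inf_inverse A \<odot> A = inf_one"
    by (simp only: P_def flip: inf_inverse_def)
  then show "lower_triangular (inf_inverse A)" "A \<odot> inf_inverse A = inf_one"
    "inf_inverse A \<odot> A = inf_one" by auto
qed

(* The defining identity 2z / (1 + e^z) = z + sum_{n \<ge> 1} (-1)^n G_{2n} z^(2n) / (2n)!. *)
lemma genocchi_gf:
  "2 * fps_X / (1 + fps_exp 1) =
     fps_X + Abs_fps (\<lambda>m. if even m \<and> 2 \<le> m
                          then (-1) ^ (m div 2) * genocchi m / fact m else 0)"
proof -
  define E where "E = fps_exp (1 :: rat)"
  define g where "g = 2 * fps_X / (1 + E)"
  define h where "h = g - fps_X"
  have E0: "fps_nth (1 + E) 0 \<noteq> 0" by (simp add: E_def)
  then have E1: "1 + E \<noteq> 0" by (metis fps_zero_nth)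
  have inv: "1 + E dvd 2 * fps_X"
    using E0 by (metis fps_is_unit_iff unit_imp_dvd)
  have g: "g * (1 + E) = 2 * fps_X"
    unfolding g_def using inv by simp
  have h: "h * (1 + E) = fps_X * (1 - E)"
    unfolding h_def using g by (simp add: algebra_simps)
  define c where "c = (\<lambda>f :: rat fps. fps_compose f (- fps_X))"
  have cm: "c (a * b) = c a * c b" and ca: "c (a + b) = c a + c b"
    and cs: "c (a - b) = c a - c b" and c1: "c 1 = 1" and cX: "c fps_X = - fps_X" for a b
    by (simp_all add: c_def fps_compose_mult_distrib fps_compose_add_distrib fps_compose_sub_distrib)
  have cE: "c E = fps_exp (-1)"
    using fps_exp_compose_linear[of 1 "-1 :: rat"] by (simp add: c_def E_def)
  have EE: "fps_exp (-1) * E = 1"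
    using fps_exp_add_mult[of "-1" "1 :: rat"] by (simp add: E_def)
  have "c h * (1 + fps_exp (-1)) = - fps_X * (1 - fps_exp (-1))"
    using arg_cong[OF h, of c] by (simp only: cm ca cs c1 cX cE)
  then have "c h * (1 + fps_exp (-1)) * E = - fps_X * (1 - fps_exp (-1)) * E" by simp
  then have "c h * (E + fps_exp (-1) * E) = - fps_X * (E - fps_exp (-1) * E)"
    by (simp only: algebra_simps mult_1_left mult_1_right)
  then have "c h * (1 + E) = h * (1 + E)"
    unfolding EE h by (simp add: algebra_simps)
  then have ch: "c h = h" using E1 by simp
  have odd: "fps_nth h m = 0" if "odd m" for m
  proof -
    have "fps_nth (c h) m = - fps_nth h m"
      using that by (simp add: c_def fps_compose_uminus')
    then show ?thesis using ch by simp
  qed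
  have "fps_nth (g * (1 + E)) 0 = 0" unfolding g by simp
  then have zero: "fps_nth h 0 = 0" by (simp add: h_def E_def)
  have gen: "(-1) ^ (m div 2) * genocchi m / fact m = fps_nth g m" for m
    by (simp add: genocchi_def g_def E_def power_mult_distrib flip: mult.assoc)
  have "h = Abs_fps (\<lambda>m. if even m \<and> 2 \<le> m
                          then (-1) ^ (m div 2) * genocchi m / fact m else 0)"
  proof (rule fps_ext)
    fix m :: nat
    have "m = 0 \<or> m = 1 \<or> 2 \<le> m" by auto
    then show "fps_nth h m = fps_nth (Abs_fps (\<lambda>m. if even m \<and> 2 \<le> m
                          then (-1) ^ (m div 2) * genocchi m / fact m else 0)) m"
      using odd[of m] zero by (auto simp: gen h_def fps_X_def)
  qed
  then show ?thesis
    unfolding h_def g_def E_def by (simp add: algebra_simps)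
qed

end

theory Submission
  imports Defs
begin

text \<open>
  Put \<open>q\<^sub>n(x) = \<Sum>\<^sub>k a(n,k) x\<^sup>2\<^sup>k\<^sup>+\<^sup>1\<close>. The generating function of the Genocchi numbers says that \<open>q\<^sub>n\<close>
  is the image of \<open>x\<^sup>2\<^sup>n\<^sup>+\<^sup>2\<close> under the operator \<open>tanh (D/2) = (e\<^sup>D - 1) / (e\<^sup>D + 1)\<close>, where \<open>D = d/dx\<close>.
  Hence \<open>q\<^sub>n\<close> is the only polynomial with \<open>q\<^sub>n(x+1) + q\<^sub>n(x) = (x+1)\<^sup>2\<^sup>n\<^sup>+\<^sup>2 - x\<^sup>2\<^sup>n\<^sup>+\<^sup>2\<close>, and each representation
  evaluates \<open>tanh (D/2)\<close> in its own way:

  \<^item> since \<open>q\<^sub>n\<close> is odd, the functional equation reads \<open>q\<^sub>n(a) - q\<^sub>n(1-a) = a\<^sup>2\<^sup>n\<^sup>+\<^sup>2 - (1-a)\<^sup>2\<^sup>n\<^sup>+\<^sup>2\<close>, and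
    \<open>(a\<^sup>m - (1-a)\<^sup>m) / (2a-1)\<close> is the \<open>m\<close>-th Fibonacci polynomial at \<open>a\<^sup>2-a\<close>;
  \<^item> \<open>tanh (D/2)\<close> maps the even part of \<open>f(x) = (x(x+1))\<^sup>i\<^sup>+\<^sup>1\<close> to its odd part, because \<open>f(-x) = f(x-1)\<close>;
  \<^item> \<open>tanh (D/2)\<close> maps \<open>x \<psi>\<^sub>j(x)\<close> to \<open>(j+1) \<psi>\<^sub>j(x)\<close>, where \<open>\<psi>\<^sub>j(x) = (x-j)(x-j+1)\<dots>(x+j)\<close>.
\<close>

section \<open>Parity splitting, odd polynomials and uniqueness\<close>

lemma sum_split_even_odd:
  fixes f :: "nat \<Rightarrow> 'a::comm_monoid_add"
  shows "(\<Sum>m\<le>2 * n + 1. f m) = (\<Sum>k\<le>n. f (2 * k)) + (\<Sum>k\<le>n. f (2 * k + 1))"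
  by (induction n) (simp_all add: algebra_simps)

lemma coeff_sum_odd_monom:
  "coeff (\<Sum>k\<le>n. monom (c k) (2 * k + 1)) (2 * j + 1) = (if j \<le> n then c j else 0)"
  by (simp add: coeff_sum coeff_monom)

lemma poly_sum_odd_monom:
  fixes x :: "'a::comm_semiring_1"
  shows "poly (\<Sum>k\<le>n. monom (c k) (2 * k + 1)) x = (\<Sum>k\<le>n. c k * x ^ (2 * k + 1))"
  by (simp only: poly_sum poly_monom)

text \<open>The difference \<open>r\<close> satisfies r(x+1) = -r(x), while a shift preserves the
  leading coefficient; that coefficient equals its own negative and is 0.\<close>

lemma poly_eqI_shift_sum:
  fixes p q :: "'a::field_char_0 poly"
  assumes "\<And>x. poly p (x + 1) + poly p x = poly q (x + 1) + poly q x"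
  shows "p = q"
proof -
  define r where "r = p - q"
  have "poly (pcompose r [:1, 1:]) x = poly (- r) x" for x
    using assms[of x] by (simp add: r_def poly_pcompose algebra_simps)
  then have "pcompose r [:1, 1:] = - r"
    by (simp add: poly_eq_poly_eq_iff[symmetric] fun_eq_iff)
  moreover have "lead_coeff (pcompose r [:1, 1:]) = lead_coeff r"
    by (subst lead_coeff_comp) simp_all
  ultimately have "lead_coeff r = 0"
    by simp
  then have "r = 0"
    by (simp only: leading_coeff_0_iff)
  then show ?thesis
    by (simp add: r_def)
qed

section \<open>The polynomials q_n and their functional equation\<close>

definition genocchi_matrix :: "rat inf_matrix" where
  "genocchi_matrix n k =
     (if k \<le> n then (-1) ^ (n - k) * (1 / of_nat (2 * k + 1)) * of_nat ((2 * n + 2) choose (2 * k))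
                * genocchi (2 * n - 2 * k + 2) else 0)"

definition genocchi_poly :: "nat \<Rightarrow> rat poly" where
  "genocchi_poly n = (\<Sum>k\<le>n. monom (genocchi_matrix n k) (2 * k + 1))"

lemma poly_genocchi_poly:
  "poly (genocchi_poly n) x = (\<Sum>k\<le>n. genocchi_matrix n k * x ^ (2 * k + 1))"
  unfolding genocchi_poly_def by (rule poly_sum_odd_monom)

text \<open>The power series of \<open>tanh (z/2)\<close>.\<close>

definition tanh_half :: "rat fps" where
  "tanh_half = Abs_fps (\<lambda>m. if odd m then
     (-1) ^ (m div 2) * genocchi (m + 1) / fact (m + 1) else 0)"

text \<open>Coefficient by coefficient, the Genocchi series 2z/(1+e^z) is z - z
  \<open>tanh_half\<close>; clear the denominator and cancel z.\<close>

lemma tanh_half_mult: "tanh_half * (1 + fps_exp 1) = fps_exp 1 - 1"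
proof -
  define E where "E = fps_exp (1 :: rat)"
  have E0: "fps_nth (1 + E) 0 \<noteq> 0" by (simp add: E_def)
  then have dvd: "1 + E dvd 2 * fps_X"
    by (metis fps_is_unit_iff unit_imp_dvd)
  have "fps_X - fps_X * tanh_half = 2 * fps_X / (1 + E)"
    unfolding E_def genocchi_gf
  proof (rule fps_ext, goal_cases)
    case (1 m)
    show ?case
      by (cases m) (auto simp: tanh_half_def fps_X_nth fps_X_mult_nth elim!: evenE oddE)
  qed
  then have "(fps_X - fps_X * tanh_half) * (1 + E) = 2 * fps_X"
    using dvd by simp
  then have "fps_X * (tanh_half * (1 + E)) = fps_X * (E - 1)"
    by (simp add: algebra_simps)
  then show ?thesis
    by (simp add: E_def)
qed

text \<open>The product e^(xz) f(z) generates f(D) x^m / m!, so this identifies q_n with tanh(D/2)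
  applied to x^(2n+2).\<close>

lemma poly_genocchi_poly_eq_fps_nth:
  "poly (genocchi_poly n) x = fact (2 * n + 2) * fps_nth (fps_exp x * tanh_half) (2 * n + 2)"
proof -
  have "fps_nth (fps_exp x * tanh_half) (2 * n + 2)
      = (\<Sum>m\<le>2 * n + 1. x ^ m / fact m * fps_nth tanh_half (2 * n + 2 - m))"
    by (simp add: fps_mult_nth atLeast0AtMost tanh_half_def)
  \<comment> \<open>\<open>tanh_half\<close> is odd, so even \<open>m\<close> contribute
    nothing.\<close>
  also have "\<dots> = (\<Sum>k\<le>n. x ^ (2 * k + 1) / fact (2 * k + 1) * fps_nth tanh_half (2 * n + 1 - 2 * k))"
    unfolding sum_split_even_odd by (simp add: tanh_half_def)
  finally have "fact (2 * n + 2) * fps_nth (fps_exp x * tanh_half) (2 * n + 2)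
      = (\<Sum>k\<le>n. fact (2 * n + 2) * (x ^ (2 * k + 1) / fact (2 * k + 1)
           * fps_nth tanh_half (2 * n + 1 - 2 * k)))"
    by (simp only: sum_distrib_left)
  also have "\<dots> = (\<Sum>k\<le>n. genocchi_matrix n k * x ^ (2 * k + 1))"
  proof (rule sum.cong, goal_cases)
    case (2 k)
    then obtain l where n: "n = k + l"
      using le_Suc_ex by auto
    have "genocchi_matrix n k = (-1) ^ l * (1 / of_nat (2 * k + 1))
        * of_nat ((2 * n + 2) choose (2 * k)) * genocchi (2 * l + 2)"
      by (simp add: genocchi_matrix_def n del: binomial_Suc_Suc)
    moreover have "of_nat ((2 * n + 2) choose (2 * k)) = (fact (2 * n + 2) / (fact (2 * k) * fact (2 * l + 2)) :: rat)"
      by (subst binomial_fact) (simp_all add: n)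
    moreover have "fps_nth tanh_half (2 * n + 1 - 2 * k) = (-1) ^ l * genocchi (2 * l + 2) / fact (2 * l + 2)"
      by (simp add: n tanh_half_def)
    moreover have "fact (2 * k + 1) = (of_nat (2 * k + 1) * fact (2 * k) :: rat)"
      by simp
    ultimately show ?case
      by (simp only: divide_inverse inverse_mult_distrib mult_ac mult_1)
  qed auto
  finally show ?thesis
    by (simp add: poly_genocchi_poly)
qed

text \<open>e^((x+1)z) + e^(xz) = e^(xz) (1 + e^z), and the last factor cancels the denominator of
  tanh(z/2).\<close>

lemma genocchi_poly_shift_sum:
  "poly (genocchi_poly n) (x + 1) + poly (genocchi_poly n) x = (x + 1) ^ (2 * n + 2) - x ^ (2 * n + 2)"
proof -
  have "fps_exp (x + 1) * tanh_half + fps_exp x * tanh_half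
      = fps_exp x * (tanh_half * (1 + fps_exp 1))"
    by (simp add: fps_exp_add_mult algebra_simps)
  also have "\<dots> = fps_exp (x + 1) - fps_exp x"
    unfolding tanh_half_mult by (simp add: fps_exp_add_mult algebra_simps)
  finally have "fps_nth (fps_exp (x + 1) * tanh_half) m + fps_nth (fps_exp x * tanh_half) m
      = ((x + 1) ^ m - x ^ m) / fact m" for m
    by (simp add: fps_eq_iff diff_divide_distrib)
  then show ?thesis
    by (simp add: poly_genocchi_poly_eq_fps_nth flip: distrib_left del: fact_Suc)
qed

lemma genocchi_poly_unique:
  assumes "\<And>x. poly p (x + 1) + poly p x = (x + 1) ^ (2 * n + 2) - x ^ (2 * n + 2)"
  shows "genocchi_poly n = p"
  by (rule poly_eqI_shift_sum) (simp only: assms genocchi_poly_shift_sum)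

lemma genocchi_poly_minus: "poly (genocchi_poly n) (- x) = - poly (genocchi_poly n) x"
  by (simp add: poly_genocchi_poly sum_negf)

subsection \<open>Fibonacci polynomials\<close>

text \<open>The Fibonacci polynomial of index n + 1; the terms with 2j > n vanish.\<close>

definition fib_sum :: "nat \<Rightarrow> 'a::comm_semiring_1 \<Rightarrow> 'a" where
  "fib_sum n y = (\<Sum>j\<le>n. of_nat ((n - j) choose j) * y ^ j)"

text \<open>Pascal's rule on every term except j = 0.\<close>

lemma fib_sum_Suc_Suc: "fib_sum (Suc (Suc n)) y = fib_sum (Suc n) y + y * fib_sum n y"
proof -
  have "fib_sum (Suc (Suc n)) y = 1 + (\<Sum>j\<le>Suc n. of_nat ((Suc n - j) choose Suc j) * y ^ Suc j)"
    unfolding fib_sum_def by (subst sum.atMost_Suc_shift) simp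
  also have "(\<Sum>j\<le>Suc n. of_nat ((Suc n - j) choose Suc j) * y ^ Suc j)
     = (\<Sum>j\<le>n. of_nat ((Suc n - j) choose Suc j) * y ^ Suc j)"
    by simp
  also have "\<dots> = (\<Sum>j\<le>n. of_nat ((n - j) choose Suc j) * y ^ Suc j)
      + (\<Sum>j\<le>n. of_nat ((n - j) choose j) * y ^ Suc j)"
    unfolding sum.distrib[symmetric] by (intro sum.cong) (auto simp: Suc_diff_le algebra_simps)
  also have "1 + ((\<Sum>j\<le>n. of_nat ((n - j) choose Suc j) * y ^ Suc j)
      + (\<Sum>j\<le>n. of_nat ((n - j) choose j) * y ^ Suc j)) = fib_sum (Suc n) y + y * fib_sum n y"
    unfolding fib_sum_def
    by (subst sum.atMost_Suc_shift) (simp add: sum_distrib_left algebra_simps)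
  finally show ?thesis .
qed

text \<open>Binet's formula: a and 1 - a are the roots of t^2 = t + (a^2 - a), and 2a - 1 is their
  difference.\<close>

lemma fib_sum_closed_form:
  fixes a :: "'a::comm_ring_1"
  shows "(2 * a - 1) * fib_sum n (a\<^sup>2 - a) = a ^ Suc n - (1 - a) ^ Suc n"
proof (induction n rule: induct_nat_012)
  case (ge2 n)
  have "(2 * a - 1) * fib_sum (Suc (Suc n)) (a\<^sup>2 - a)
      = (2 * a - 1) * fib_sum (Suc n) (a\<^sup>2 - a) + (a\<^sup>2 - a) * ((2 * a - 1) * fib_sum n (a\<^sup>2 - a))"
    by (simp add: fib_sum_Suc_Suc algebra_simps)
  also have "\<dots> = a ^ Suc (Suc (Suc n)) - (1 - a) ^ Suc (Suc (Suc n))"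
    unfolding ge2 by (simp add: algebra_simps power2_eq_square)
  finally show ?case .
qed (simp_all add: fib_sum_def algebra_simps power2_eq_square)

lemma fib_sum_truncate:
  assumes "n \<le> 2 * m + 1" "m \<le> n"
  shows "fib_sum n y = (\<Sum>j\<le>m. of_nat ((n - j) choose j) * y ^ j)"
proof -
  have "(n - j) choose j = 0" if "m < j" for j
    using that assms by (intro binomial_eq_0) auto
  then show ?thesis
    unfolding fib_sum_def using assms(2)
    by (intro sum.mono_neutral_right) (auto simp del: binomial_eq_0_iff)
qed

text \<open>Rows are compared as polynomials in y: row i is \<open>fib_sum (2 * i)\<close> in the
  right factor and \<open>fib_sum (2 * i + 1)\<close> in the product.\<close>

lemma genocchi_matrix_mult_fibonacci:
  "genocchi_matrix \<odot> (\<lambda>i j. of_bool (j \<le> i) * of_nat ((2 * i - j) choose j))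
     = (\<lambda>i j. of_bool (j \<le> i) * of_nat ((2 * i + 1 - j) choose j))"
proof (intro ext)
  fix n j
  define Q where "Q = (\<lambda>i j. of_bool (j \<le> i) * of_nat ((2 * i - j) choose j) :: rat)"
  define P where "P = (\<lambda>j. of_bool (j \<le> n) * of_nat ((2 * n + 1 - j) choose j) :: rat)"
  define p where "p = (\<Sum>j\<le>n. monom ((genocchi_matrix \<odot> Q) n j - P j) j)"
  have Q: "(\<Sum>j\<le>n. Q k j * y ^ j) = fib_sum (2 * k) y" if "k \<le> n" for k y
    using that by (subst fib_sum_truncate[of _ k])
      (auto simp: Q_def intro!: sum.mono_neutral_cong_right)
  have P: "(\<Sum>j\<le>n. P j * y ^ j) = fib_sum (2 * n + 1) y" for y
    by (subst fib_sum_truncate[of _ n]) (auto simp: P_def)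
  have p: "poly p y = (\<Sum>k\<le>n. genocchi_matrix n k * fib_sum (2 * k) y) - fib_sum (2 * n + 1) y" for y
  proof -
    have "poly p y = (\<Sum>j\<le>n. \<Sum>k\<le>n. genocchi_matrix n k * (Q k j * y ^ j)) - (\<Sum>j\<le>n. P j * y ^ j)"
      by (simp add: p_def poly_sum poly_monom inf_mult_def left_diff_distrib sum_subtractf
          sum_distrib_right mult.assoc)
    also have "(\<Sum>j\<le>n. \<Sum>k\<le>n. genocchi_matrix n k * (Q k j * y ^ j))
        = (\<Sum>k\<le>n. genocchi_matrix n k * (\<Sum>j\<le>n. Q k j * y ^ j))"
      by (subst sum.swap) (simp add: sum_distrib_left)
    finally show ?thesis
      by (simp add: P Q)
  qed
  \<comment> \<open>Substituting y = a^2 - a and multiplying by 2a - 1 makes the closed form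
    applicable; both are undone below, since 2a - 1 is a nonzero polynomial and a^2 - a is not
    constant.\<close>
  have "poly ([:-1, 2:] * pcompose p [:0, -1, 1:]) a = poly 0 a" for a
  proof -
    have "poly ([:-1, 2:] * pcompose p [:0, -1, 1:]) a = (2 * a - 1) * poly p (a\<^sup>2 - a)"
      by (simp add: poly_pcompose power2_eq_square algebra_simps)
    also have "\<dots> = (\<Sum>k\<le>n. genocchi_matrix n k * ((2 * a - 1) * fib_sum (2 * k) (a\<^sup>2 - a)))
        - (2 * a - 1) * fib_sum (2 * n + 1) (a\<^sup>2 - a)"
      unfolding p right_diff_distrib sum_distrib_left by (simp add: mult_ac)
    also have "\<dots> = (\<Sum>k\<le>n. genocchi_matrix n k * (a ^ (2 * k + 1) - (1 - a) ^ (2 * k + 1)))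
        - (a ^ (2 * n + 2) - (1 - a) ^ (2 * n + 2))"
      unfolding fib_sum_closed_form by simp
    also have "\<dots> = poly (genocchi_poly n) a - poly (genocchi_poly n) (1 - a)
        - (a ^ (2 * n + 2) - (1 - a) ^ (2 * n + 2))"
      unfolding poly_genocchi_poly right_diff_distrib sum_subtractf ..
    \<comment> \<open>Oddness of q_n and the even exponent turn 1 - a into a - 1, where the
      functional equation applies.\<close>
    also have "poly (genocchi_poly n) (1 - a) = - poly (genocchi_poly n) (a - 1)"
      using genocchi_poly_minus[of n "a - 1"] by simp
    also have "(1 - a) ^ (2 * n + 2) = (a - 1) ^ (2 * n + 2)"
      using power_minus_even[of "2 * n + 2" "a - 1"] by simp
    also have "poly (genocchi_poly n) a - - poly (genocchi_poly n) (a - 1)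
        - (a ^ (2 * n + 2) - (a - 1) ^ (2 * n + 2)) = 0"
      using genocchi_poly_shift_sum[of n "a - 1"] by simp
    finally show ?thesis by simp
  qed
  then have "poly ([:-1, 2:] * pcompose p [:0, -1, 1:]) = poly 0"
    by (rule ext)
  then have "[:-1, 2:] * pcompose p [:0, -1, 1:] = 0"
    by (simp only: poly_eq_poly_eq_iff)
  then have "pcompose p [:0, -1, 1:] = 0"
    unfolding mult_eq_0_iff by simp
  then have "p = 0"
    using pcompose_eq_0 by force
  then have "coeff p j = 0"
    by simp
  then have "(genocchi_matrix \<odot> Q) n j = P j" if "j \<le> n"
    using that by (simp add: p_def coeff_sum coeff_monom)
  moreover have "(genocchi_matrix \<odot> Q) n j = P j" if "\<not> j \<le> n"
    using that by (simp add: inf_mult_def Q_def P_def)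
  ultimately show "(genocchi_matrix \<odot> Q) n j = P j"
    by blast
qed

subsection \<open>Even and odd parts\<close>

text \<open>Expand (c x + x^2)^(i+1) with c^2 = 1: the term with c^m has degree 2i+2-m in x, of the
  parity of m, so c survives exactly in the odd part \<open>d\<close>.\<close>

lemma binomial_even_odd_parts:
  fixes x :: "'a::comm_ring_1" and i :: nat
  defines "e \<equiv> (\<Sum>j\<le>i. of_nat ((i + 1) choose (2 * i - 2 * j)) * x ^ (2 * j + 2))"
    and "d \<equiv> (\<Sum>j\<le>i. of_nat ((i + 1) choose (2 * i - 2 * j + 1)) * x ^ (2 * j + 1))"
  shows "(x * (x + 1)) ^ (i + 1) = e + d" and "(x * (x - 1)) ^ (i + 1) = e - d"
proof -
  have *: "(x * (x + c)) ^ (i + 1) = e + c * d" if "c\<^sup>2 = 1" for c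
  proof -
    have c: "c ^ (2 * k) = 1" for k
      by (simp add: power_mult that)
    have "(x * (x + c)) ^ (i + 1) = (c * x + x\<^sup>2) ^ (i + 1)"
      by (simp add: algebra_simps power2_eq_square)
    also have "\<dots> = (\<Sum>m\<le>i + 1. of_nat ((i + 1) choose m) * (c ^ m * x ^ (2 * i + 2 - m)))"
      unfolding binomial_ring
    proof (rule sum.cong, goal_cases)
      case (2 m)
      then have "2 * i + 2 - m = m + 2 * (i + 1 - m)" by auto
      then show ?case
        by (simp only: power_mult_distrib power_add power_mult mult.assoc)
    qed simp
    \<comment> \<open>The added binomials vanish; the new bound suits the split by parity.\<close>
    also have "\<dots> = (\<Sum>m\<le>2 * i + 1. of_nat ((i + 1) choose m) * (c ^ m * x ^ (2 * i + 2 - m)))"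
      by (rule sum.mono_neutral_left) (auto simp: binomial_eq_0)
    also have "\<dots> = (\<Sum>k\<le>i. of_nat ((i + 1) choose (2 * k)) * x ^ (2 * i + 2 - 2 * k))
        + c * (\<Sum>k\<le>i. of_nat ((i + 1) choose (2 * k + 1)) * x ^ (2 * i + 1 - 2 * k))"
      unfolding sum_split_even_odd sum_distrib_left
      by (intro arg_cong2[where f = "(+)"] sum.cong)
        (simp_all add: c mult.left_commute del: binomial_Suc_Suc)
    also have "(\<Sum>k\<le>i. of_nat ((i + 1) choose (2 * k)) * x ^ (2 * i + 2 - 2 * k)) = e"
      unfolding e_def by (rule sum.reindex_bij_witness[of _ "\<lambda>k. i - k" "\<lambda>k. i - k"])
        (auto simp: diff_mult_distrib2 Suc_diff_le)
    also have "(\<Sum>k\<le>i. of_nat ((i + 1) choose (2 * k + 1)) * x ^ (2 * i + 1 - 2 * k)) = d"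
      unfolding d_def by (rule sum.reindex_bij_witness[of _ "\<lambda>k. i - k" "\<lambda>k. i - k"])
        (auto simp: diff_mult_distrib2 Suc_diff_le)
    finally show ?thesis .
  qed
  show "(x * (x + 1)) ^ (i + 1) = e + d" "(x * (x - 1)) ^ (i + 1) = e - d"
    using *[of 1] *[of "-1"] by simp_all
qed

text \<open>Row i of the left factor holds the coefficients of the even part \<open>e\<close>, so
  the product applies tanh(D/2) to \<open>e\<close>; uniqueness identifies the result with
  \<open>d\<close>.\<close>

lemma binomial_mult_genocchi_matrix:
  "(\<lambda>i j. of_bool (j \<le> i) * of_nat ((i + 1) choose (2 * i - 2 * j))) \<odot> genocchi_matrix
     = (\<lambda>i j. of_bool (j \<le> i) * of_nat ((i + 1) choose (2 * i - 2 * j + 1)))"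
proof (intro ext)
  fix i j
  define B where "B = (\<lambda>i j. of_bool (j \<le> i) * of_nat ((i + 1) choose (2 * i - 2 * j)) :: rat)"
  define C where "C = (\<lambda>j. of_bool (j \<le> i) * of_nat ((i + 1) choose (2 * i - 2 * j + 1)) :: rat)"
  define e where "e = (\<lambda>x. \<Sum>j\<le>i. of_nat ((i + 1) choose (2 * i - 2 * j)) * x ^ (2 * j + 2) :: rat)"
  define d where "d = (\<lambda>x. \<Sum>j\<le>i. of_nat ((i + 1) choose (2 * i - 2 * j + 1)) * x ^ (2 * j + 1) :: rat)"
  have parts: "(x * (x + 1)) ^ (i + 1) = e x + d x" "(x * (x - 1)) ^ (i + 1) = e x - d x" for x
    unfolding e_def d_def by (rule binomial_even_odd_parts)+
  define p where "p = (\<Sum>l\<le>i. smult (B i l) (genocchi_poly l))"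
  define q where "q = (\<Sum>l\<le>i. monom (C l) (2 * l + 1))"
  have q: "poly q x = d x" for x
    unfolding q_def poly_sum_odd_monom by (simp add: d_def C_def)
  have "poly p (x + 1) + poly p x = poly q (x + 1) + poly q x" for x
  proof -
    have "poly p (x + 1) + poly p x
       = (\<Sum>l\<le>i. B i l * (poly (genocchi_poly l) (x + 1) + poly (genocchi_poly l) x))"
      by (simp add: p_def poly_sum sum.distrib distrib_left)
    also have "\<dots> = e (x + 1) - e x"
      unfolding genocchi_poly_shift_sum by (simp add: e_def B_def sum_subtractf right_diff_distrib)
    also have "\<dots> = d (x + 1) + d x"
    proof -
      \<comment> \<open>Both sides are (x(x+1))^(i+1): the second expansion at x + 1 and the first
        at x.\<close>
      have "e (x + 1) - d (x + 1) = e x + d x"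
        unfolding parts[symmetric] by (simp add: mult.commute)
      then show ?thesis by simp
    qed
    finally show ?thesis
      by (simp add: q)
  qed
  then have "coeff p (2 * j + 1) = coeff q (2 * j + 1)"
    by (metis poly_eqI_shift_sum)
  also have "coeff p (2 * j + 1) = (B \<odot> genocchi_matrix) i j"
    unfolding p_def inf_mult_def coeff_sum coeff_smult genocchi_poly_def coeff_sum_odd_monom
    by (intro sum.cong) (simp_all add: genocchi_matrix_def)
  also have "coeff q (2 * j + 1) = C j"
    unfolding q_def coeff_sum_odd_monom by (simp add: C_def)
  finally show "(B \<odot> genocchi_matrix) i j = C j" .
qed

subsection \<open>Central factorials\<close>

text \<open>The product \<psi> of the overview, with the factors x - l and x + l paired.\<close>

definition central_prod :: "nat \<Rightarrow> 'a::comm_ring_1 \<Rightarrow> 'a" where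
  "central_prod n x = x * (\<Prod>l=1..n. x\<^sup>2 - (of_nat l)\<^sup>2)"

lemma central_prod_0 [simp]: "central_prod 0 x = x"
  by (simp add: central_prod_def)

lemma central_prod_Suc:
  "central_prod (Suc n) x = central_prod n x * (x\<^sup>2 - (of_nat (Suc n))\<^sup>2)"
  by (simp add: central_prod_def mult.assoc)

text \<open>Both sides are (x-n)(x-n+1)...(x+n+1).\<close>

lemma central_prod_shift:
  "(x - of_nat n) * central_prod n (x + 1) = (x + 1 + of_nat n) * central_prod n x"
proof (induction n)
  case (Suc n)
  have "(x - of_nat (Suc n)) * central_prod (Suc n) (x + 1)
      = (x - of_nat (Suc n)) * (x + 2 + of_nat n) * ((x - of_nat n) * central_prod n (x + 1))"
    by (simp add: central_prod_Suc algebra_simps power2_eq_square)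
  also have "\<dots> = (x + 1 + of_nat (Suc n)) * central_prod (Suc n) x"
    unfolding Suc by (simp add: central_prod_Suc algebra_simps power2_eq_square)
  finally show ?case .
qed (simp add: algebra_simps)

text \<open>The functional-equation form of the claim that tanh(D/2) maps x \<psi>(x) to (n+1)
  \<psi>(x).\<close>

lemma central_prod_shift_sum:
  "of_nat (n + 1) * (central_prod n (x + 1) + central_prod n x)
     = (x + 1) * central_prod n (x + 1) - x * central_prod n x"
  using central_prod_shift[of x n] by (simp add: algebra_simps)

text \<open>Writing x^2 = (x^2 - (k+1)^2) + (k+1)^2 in each term reproduces the recurrence of
  T.\<close>

lemma power_eq_sum_central_fact2:
  "x ^ (2 * n + 2) = (\<Sum>k\<le>n. of_nat (central_fact2 (n + 1) (k + 1)) * (x * central_prod k x))"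
proof (induction n)
  case (Suc n)
  let ?T = "\<lambda>n k. of_nat (central_fact2 n k)" and ?c = "\<lambda>k. x * central_prod k x"
  have "x ^ (2 * Suc n + 2) = (\<Sum>k\<le>n. ?T (n + 1) (k + 1) * (x\<^sup>2 * ?c k))"
    using Suc by (simp add: sum_distrib_left power2_eq_square mult_ac)
  also have "\<dots> = (\<Sum>k\<le>n. ?T (n + 1) (k + 1) * ?c (k + 1) + ?T (n + 1) (k + 1) * (of_nat (k + 1))\<^sup>2 * ?c k)"
    by (intro sum.cong) (simp_all add: central_prod_Suc algebra_simps)
  \<comment> \<open>The boundary terms are T(n+1,0) = 0 and T(n+1,n+2) = 0.\<close>
  also have "\<dots> = (\<Sum>k\<le>Suc n. ?T (n + 1) k * ?c k)
      + (\<Sum>k\<le>Suc n. (of_nat (k + 1))\<^sup>2 * ?T (n + 1) (k + 1) * ?c k)"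
  proof -
    have "(\<Sum>k\<le>n. ?T (n + 1) (k + 1) * ?c (k + 1)) = (\<Sum>k\<le>Suc n. ?T (n + 1) k * ?c k)"
      by (subst sum.atMost_Suc_shift) (simp del: central_fact2.simps(3))
    moreover have "(\<Sum>k\<le>n. ?T (n + 1) (k + 1) * (of_nat (k + 1))\<^sup>2 * ?c k)
        = (\<Sum>k\<le>Suc n. (of_nat (k + 1))\<^sup>2 * ?T (n + 1) (k + 1) * ?c k)"
      by (simp add: lower_triangular_central_fact2 mult_ac del: central_fact2.simps(3))
    ultimately show ?thesis
      unfolding sum.distrib by simp
  qed
  also have "\<dots> = (\<Sum>k\<le>Suc n. ?T (Suc n + 1) (k + 1) * ?c k)"
    by (simp add: sum.distrib distrib_right del: sum.atMost_Suc)
  finally show ?case .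
qed (simp add: power2_eq_square)

text \<open>The new factor x^2 - (n+1)^2 reproduces the recurrence of t.\<close>

lemma central_prod_eq_sum_central_fact1:
  "central_prod n x = (\<Sum>k\<le>n. of_int (central_fact1 (n + 1) (k + 1)) * x ^ (2 * k + 1))"
proof (induction n)
  case (Suc n)
  let ?t = "\<lambda>n k. of_int (central_fact1 n k)"
  have "central_prod (Suc n) x = (\<Sum>k\<le>n. ?t (n + 1) (k + 1) * x ^ (2 * k + 1)) * (x\<^sup>2 - (of_nat (Suc n))\<^sup>2)"
    unfolding central_prod_Suc Suc ..
  also have "\<dots> = (\<Sum>k\<le>n. ?t (n + 1) (k + 1) * x ^ (2 * (k + 1) + 1))
      - (\<Sum>k\<le>n. (of_nat (Suc n))\<^sup>2 * ?t (n + 1) (k + 1) * x ^ (2 * k + 1))"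
    unfolding sum_distrib_right sum_subtractf[symmetric]
    by (intro sum.cong) (simp_all add: algebra_simps power2_eq_square del: central_fact1.simps(3))
  also have "\<dots> = (\<Sum>k\<le>Suc n. ?t (n + 1) k * x ^ (2 * k + 1))
      - (\<Sum>k\<le>Suc n. (of_nat (Suc n))\<^sup>2 * ?t (n + 1) (k + 1) * x ^ (2 * k + 1))"
  proof -
    have "(\<Sum>k\<le>n. ?t (n + 1) (k + 1) * x ^ (2 * (k + 1) + 1))
        = (\<Sum>k\<le>Suc n. ?t (n + 1) k * x ^ (2 * k + 1))"
      by (subst sum.atMost_Suc_shift) (simp del: central_fact1.simps(3))
    then show ?thesis
      by (simp add: lower_triangular_central_fact1)
  qed
  also have "\<dots> = (\<Sum>k\<le>Suc n. ?t (Suc n + 1) (k + 1) * x ^ (2 * k + 1))"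
    by (simp add: sum_subtractf left_diff_distrib del: sum.atMost_Suc)
  finally show ?case .
qed simp

text \<open>T expands x^(2n+2) in the x \<psi>, the diagonal matrix applies tanh(D/2), and t expands
  each \<psi> in odd powers of x.\<close>

lemma genocchi_matrix_central_factorial:
  "genocchi_matrix = (\<lambda>i j. of_nat (central_fact2 (i + 1) (j + 1)))
       \<odot> (\<lambda>i j. of_bool (i = j) * of_nat (i + 1))
       \<odot> (\<lambda>i j. of_int (central_fact1 (i + 1) (j + 1)))"
    (is "_ = ?M")
proof (intro ext)
  fix n k
  let ?T = "\<lambda>n k. of_nat (central_fact2 (n + 1) (k + 1)) :: rat"
  let ?t = "\<lambda>n k. of_int (central_fact1 (n + 1) (k + 1)) :: rat"
  have M: "?M n k = (\<Sum>j\<le>n. ?T n j * of_nat (j + 1) * ?t j k)" for k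
    unfolding inf_mult_def
    by (intro sum.cong) (auto simp: of_bool_def if_distrib if_distribR cong: if_cong)
  define p where "p = (\<Sum>k\<le>n. monom (?M n k) (2 * k + 1))"
  have p: "poly p x = (\<Sum>j\<le>n. ?T n j * (of_nat (j + 1) * central_prod j x))" for x
  proof -
    have "poly p x = (\<Sum>k\<le>n. \<Sum>j\<le>n. ?T n j * (of_nat (j + 1) * (?t j k * x ^ (2 * k + 1))))"
      unfolding p_def poly_sum_odd_monom M sum_distrib_right mult.assoc ..
    also have "\<dots> = (\<Sum>j\<le>n. ?T n j * (of_nat (j + 1) * (\<Sum>k\<le>n. ?t j k * x ^ (2 * k + 1))))"
      unfolding sum_distrib_left by (rule sum.swap)
    also have "\<dots> = (\<Sum>j\<le>n. ?T n j * (of_nat (j + 1) * central_prod j x))"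
    proof (rule sum.cong, goal_cases)
      case (2 j)
      then have "(\<Sum>k\<le>n. ?t j k * x ^ (2 * k + 1)) = central_prod j x"
        unfolding central_prod_eq_sum_central_fact1
        by (intro sum.mono_neutral_right) (auto simp: lower_triangular_central_fact1)
      then show ?case by simp
    qed simp
    finally show ?thesis .
  qed
  have "poly p (x + 1) + poly p x = (x + 1) ^ (2 * n + 2) - x ^ (2 * n + 2)" for x
    unfolding p power_eq_sum_central_fact2 sum.distrib[symmetric] sum_subtractf[symmetric]
      distrib_left[symmetric] right_diff_distrib[symmetric] central_prod_shift_sum ..
  then have "genocchi_poly n = p"
    by (rule genocchi_poly_unique)
  then have "coeff (genocchi_poly n) (2 * k + 1) = coeff p (2 * k + 1)"
    by simp
  then have "genocchi_matrix n k = ?M n k" if "k \<le> n"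
    using that unfolding genocchi_poly_def p_def coeff_sum_odd_monom by simp
  moreover have "genocchi_matrix n k = ?M n k" if "\<not> k \<le> n"
    unfolding M using that by (simp add: genocchi_matrix_def lower_triangular_central_fact1)
  ultimately show "genocchi_matrix n k = ?M n k"
    by blast
qed

section \<open>From product identities to inverses\<close>

lemma eq_mult_inf_inverse:
  assumes "lower_triangular A" "lower_triangular Q" "\<And>i. Q i i \<noteq> 0" "A \<odot> Q = P"
  shows "A = P \<odot> inf_inverse Q"
  using assms inf_inverse_properties(2)[OF assms(2,3)]
  by (metis inf_mult_assoc inf_mult_one)

lemma eq_inf_inverse_mult:
  assumes "lower_triangular B" "\<And>i. B i i \<noteq> 0" "B \<odot> A = C"
  shows "A = inf_inverse B \<odot> C"
  using assms inf_inverse_properties(3)[OF assms(1,2)]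
  by (metis inf_mult_assoc inf_one_mult)

theorem theorem4p2:
  fixes A :: "rat inf_matrix"
  assumes "\<And>n k. k \<le> n \<Longrightarrow>
      A n k = (-1) ^ (n - k) * (1 / of_nat (2 * k + 1)) * of_nat ((2 * n + 2) choose (2 * k))
                * genocchi (2 * n - 2 * k + 2)"
    and "\<And>n k. n < k \<Longrightarrow> A n k = 0"
  shows "(A = (\<lambda>i j. of_bool (j \<le> i) * of_nat ((2 * i + 1 - j) choose j))
                   \<odot> inf_inverse (\<lambda>i j. of_bool (j \<le> i) * of_nat ((2 * i - j) choose j)))
    \<and> (A = inf_inverse (\<lambda>i j. of_bool (j \<le> i) * of_nat ((i + 1) choose (2 * i - 2 * j)))
                   \<odot> (\<lambda>i j. of_bool (j \<le> i) * of_nat ((i + 1) choose (2 * i - 2 * j + 1))))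
    \<and> (A = (\<lambda>i j. of_nat (central_fact2 (i + 1) (j + 1)))
                   \<odot> (\<lambda>i j. of_bool (i = j) * of_nat (i + 1))
                   \<odot> (\<lambda>i j. of_int (central_fact1 (i + 1) (j + 1))))"
proof -
  have A: "A = genocchi_matrix"
    using assms by (intro ext) (simp add: genocchi_matrix_def)
  show ?thesis
    \<comment> \<open>The inverted matrices have unit diagonals, with entries binom(i,i) and
      binom(i+1,0).\<close>
    unfolding A
    by (intro conjI eq_mult_inf_inverse eq_inf_inverse_mult genocchi_matrix_mult_fibonacci
        binomial_mult_genocchi_matrix genocchi_matrix_central_factorial)
      (simp_all add: lower_triangular_def genocchi_matrix_def)
qed

end
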